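(* As formal power series in $t$, $$1+\sum_{\pi\neq\emptyset} x^{1+(12)\pi}y^{(21)\pi}p^{(2\text{-}31)\pi}q^{(31\text{-}2)\pi}t^{|\pi|}=\cfrac{1}{1-\cfrac{x[1]_{p,q}t}{1-\cfrac{y[1]_{p,q}t}{1-\cfrac{x[2]_{p,q}t}{1-\cfrac{y[2]_{p,q}t}{\ddots}}}}},$$ where the sum is over all nonempty permutations $\pi$ of $[n]$, $n\ge1$, the continued fraction has successive partial numerators $x[1]_{p,q}t,\,y[1]_{p,q}t,\,x[2]_{p,q}t,\,y[2]_{p,q}t,\,x[3]_{p,q}t,\dots$, and $[n]_{p,q}=q^{n-1}+pq^{n-2}+\cdots+p^{n-2}q+p^{n-1}$.
   Context: For a permutation $\pi=a_1\cdots a_n$: $|\pi|=n$; $(12)\pi$ is the number of $i$ with $a_i<a_{i+1}$ (ascents); $(21)\pi$ is the number of $i$ with $a_i>a_{i+1}$ (descents); $(2\text{-}31)\pi$ is the number of pairs $(i,j)$ with $1\le i<j<n$ and $a_{j+1}<a_i<a_j$; $(31\text{-}2)\pi$ is the number of pairs $(i,j)$ with $i+1<j\le n$ and $a_{i+1}<a_j<a_i$. *)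

theory Defs
  imports
    "HOL-Computational_Algebra.Formal_Power_Series"
    "HOL-Combinatorics.Multiset_Permutations"
begin

text \<open>
  A permutation \<open>a\<^sub>1 \<dots> a\<^sub>n\<close> of \<open>[n]\<close> is represented by its one-line notation, a list in
  \<^term>\<open>permutations_of_set {1..n::nat}\<close>. List positions start at \<open>0\<close>, so
  \<open>a\<^sub>i\<close> is the list entry at position \<open>i - 1\<close>.
\<close>

definition pat_12 :: "nat list \<Rightarrow> nat" where
  "pat_12 a = card {i. Suc i < length a \<and> a ! i < a ! Suc i}"

definition pat_21 :: "nat list \<Rightarrow> nat" where
  "pat_21 a = card {i. Suc i < length a \<and> a ! i > a ! Suc i}"

definition pat_2_31 :: "nat list \<Rightarrow> nat" where
  "pat_2_31 a =
     card {(i, j). i < j \<and> Suc j < length a \<and> a ! Suc j < a ! i \<and> a ! i < a ! j}"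

definition pat_31_2 :: "nat list \<Rightarrow> nat" where
  "pat_31_2 a =
     card {(i, j). Suc i < j \<and> j < length a \<and> a ! Suc i < a ! j \<and> a ! j < a ! i}"

definition pq_bracket :: "'a::comm_ring_1 \<Rightarrow> 'a \<Rightarrow> nat \<Rightarrow> 'a" where
  "pq_bracket p q n = (\<Sum>k<n. p ^ k * q ^ (n - 1 - k))"

text \<open>
  \<open>cfrac_tail c k N\<close> is the finite continued fraction
  \<open>1 / (1 - c\<^sub>k / (1 - c\<^sub>k\<^sub>+\<^sub>1 / (\<dots> / (1 - c\<^sub>k\<^sub>+\<^sub>N\<^sub>-\<^sub>1))))\<close>. The coefficients only form a
  commutative ring, so the reciprocal is taken with \<^term>\<open>fps_right_inverse\<close>, whose second
  argument is the inverse of the constant coefficient. This is a reciprocal whenever every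
  \<open>c\<^sub>i\<close> has constant coefficient \<open>0\<close>, as then every denominator has constant coefficient \<open>1\<close>.
\<close>

fun cfrac_tail :: "(nat \<Rightarrow> 'a::comm_ring_1 fps) \<Rightarrow> nat \<Rightarrow> nat \<Rightarrow> 'a fps" where
  "cfrac_tail c k 0 = 1"
| "cfrac_tail c k (Suc N) = fps_right_inverse (1 - c k * cfrac_tail c (Suc k) N) 1"

text \<open>
  An infinite continued fraction denotes the limit of its convergents in the metric of formal
  power series, i.e. every coefficient is eventually constant along the convergents.
\<close>

definition has_cfrac :: "'a::comm_ring_1 fps \<Rightarrow> (nat \<Rightarrow> 'a fps) \<Rightarrow> bool" where
  "has_cfrac F c \<longleftrightarrow> (\<lambda>N. cfrac_tail c 0 N) \<longlonglongrightarrow> F"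

lemma cfrac_tail_reciprocal:
  assumes "\<And>i. fps_nth (c i) 0 = 0"
  shows "cfrac_tail c k (Suc N) * (1 - c k * cfrac_tail c (Suc k) N) = 1"
proof -
  let ?d = "1 - c k * cfrac_tail c (Suc k) N"
  have "?d * fps_right_inverse ?d 1 = 1"
    using assms by (intro fps_right_inverse) simp
  then show ?thesis by (simp add: mult.commute)
qed

end

theory Submission
  imports Defs
begin

text \<open>
  A permutation \<open>\<pi>\<close> of \<open>[n]\<close>, extended to \<open>0 \<pi> \<infinity>\<close>, is built by inserting \<open>1, 2, \<dots>, n\<close> in this order
  (the bijection of Francon and Viennot). After stage \<open>v\<close> every maximal run of letters \<open>> v\<close> is recorded by one letter
  \<open>\<infinity>\<close>, so the state is a word with \<open>h + 1\<close> letters \<open>\<infinity>\<close>, the last one at the end. The next letter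
  \<open>u = v + 1\<close> replaces some \<open>\<infinity>\<close> by one of \<open>u\<close>, \<open>\<infinity> u\<close>, \<open>u \<infinity>\<close>, \<open>\<infinity> u \<infinity>\<close> (the last two only, at the end).
  It is reached by a descent iff \<open>\<infinity>\<close> remains on its left, and each \<open>\<infinity>\<close> followed by a letter is the
  top of a descent straddling \<open>u\<close>; choosing among the letters \<open>\<infinity>\<close> therefore contributes
  \<open>[h]\<^sub>p\<^sub>,\<^sub>q\<close> or \<open>[h + 1]\<^sub>p\<^sub>,\<^sub>q\<close>. The resulting recurrence over \<open>h\<close> is that of weighted Motzkin paths,
  which is the even contraction of the Dyck path recurrence of the continued fraction.
\<close>

section \<open>Continued fractions from three-term recurrences\<close>

text \<open>Euler's method: \<open>H k / H (k - 1)\<close>, with \<open>H (-1) = 1\<close>, is the \<open>k\<close>-th tail of the continued fraction.\<close>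

lemma has_cfrac_of_three_term:
  fixes H :: "nat \<Rightarrow> 'a::comm_ring_1 fps" and c :: "nat \<Rightarrow> 'a"
  assumes H0: "H 0 = 1 + fps_const (c 0) * fps_X * H 1"
    and HS: "\<And>k. H (Suc k) = H k + fps_const (c (Suc k)) * fps_X * H (Suc (Suc k))"
  shows "has_cfrac (H 0) (\<lambda>k. fps_const (c k) * fps_X)"
proof -
  define C where "C = (\<lambda>k. fps_const (c k) * fps_X)"
  define G where "G k = (case k of 0 \<Rightarrow> 1 | Suc j \<Rightarrow> H j)" for k
  have G: "G (Suc k) = G k + C k * G (Suc (Suc k))" for k
  proof (cases k)
    case 0
    show ?thesis unfolding 0 G_def C_def by (simp, rule H0[unfolded One_nat_def])
  next
    case (Suc j)
    show ?thesis unfolding Suc G_def C_def nat.case by (rule HS)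
  qed
  \<comment> \<open>Every partial numerator carries a factor \<open>fps_X\<close>, so each further
    level of the convergent raises the order of the error by one.\<close>
  have approx: "\<exists>R. G (Suc k) = G k * cfrac_tail C k N + fps_X ^ Suc N * R" for k N
  proof (induction N arbitrary: k)
    case 0
    show ?case
      by (rule exI[of _ "fps_const (c k) * G (Suc (Suc k))"]) (simp only: G[of k] C_def cfrac_tail.simps power_one_right mult_1_right mult_1_left mult_ac One_nat_def[symmetric])
  next
    case (Suc N)
    define S where "S = cfrac_tail C k (Suc N)"
    define T where "T = cfrac_tail C (Suc k) N"
    obtain R where R: "G (Suc (Suc k)) = G (Suc k) * T + fps_X ^ Suc N * R"
      using Suc.IH[of "Suc k"] unfolding T_def by blast
    have inv: "S * (1 - C k * T) = 1"
      unfolding S_def T_def by (rule cfrac_tail_reciprocal) (simp add: C_def)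
    have "G (Suc k) = G (Suc k) * (S * (1 - C k * T))"
      by (simp only: inv mult_1_right)
    also have "\<dots> = S * ((G (Suc k) - C k * G (Suc (Suc k))) + C k * (fps_X ^ Suc N * R))"
      unfolding R by (simp only: ring_distribs mult_1_right mult_ac diff_add_eq add_diff_eq) simp
    also have "G (Suc k) - C k * G (Suc (Suc k)) = G k"
      by (simp only: G[of k] add_diff_cancel_right')
    also have "S * (G k + C k * (fps_X ^ Suc N * R)) =
        G k * S + fps_X ^ Suc (Suc N) * (S * fps_const (c k) * R)"
      by (simp only: C_def power_Suc ring_distribs mult_ac)
    finally have "G (Suc k) = G k * S + fps_X ^ Suc (Suc N) * (S * fps_const (c k) * R)" .
    then show ?case unfolding S_def by blast
  qed
  have nth: "fps_nth (cfrac_tail C 0 N) n = fps_nth (H 0) n" if "n \<le> N" for n N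
  proof -
    obtain R where "H 0 = cfrac_tail C 0 N + fps_X ^ Suc N * R"
      using approx[of 0 N] by (auto simp: G_def)
    then show ?thesis using that by (simp add: fps_X_power_mult_nth del: power_Suc)
  qed
  have "(\<lambda>N. cfrac_tail C 0 N) \<longlonglongrightarrow> H 0"
    unfolding tendsto_fps_iff
  proof
    fix n
    show "\<forall>\<^sub>F N in sequentially. fps_nth (cfrac_tail C 0 N) n = fps_nth (H 0) n"
      unfolding eventually_sequentially using nth by blast
  qed
  then show ?thesis by (simp add: has_cfrac_def C_def)
qed

text \<open>Coefficient of \<open>t\<^sup>n\<close> in the product of the tails \<open>F\<^sub>0 \<cdots> F\<^sub>k\<close> of the continued fraction, i.e. the weight
  of Dyck prefixes from level \<open>0\<close> to level \<open>k\<close> with \<open>n\<close> down steps, the step \<open>i + 1 \<rightarrow> i\<close> having weight \<open>c i\<close>;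
  the recursion removes the last step.\<close>

fun cfrac_coeff :: "(nat \<Rightarrow> 'a::comm_ring_1) \<Rightarrow> nat \<Rightarrow> nat \<Rightarrow> 'a" where
  "cfrac_coeff c 0 k = 1"
| "cfrac_coeff c (Suc n) 0 = c 0 * cfrac_coeff c n 1"
| "cfrac_coeff c (Suc n) (Suc k) = cfrac_coeff c (Suc n) k + c (Suc k) * cfrac_coeff c n (Suc (Suc k))"

text \<open>The recursion of \<open>cfrac_coeff\<close> is the three-term recurrence read off
  coefficient by coefficient.\<close>

lemma has_cfrac_cfrac_coeff:
  "has_cfrac (Abs_fps (\<lambda>n. cfrac_coeff c n 0)) (\<lambda>k. fps_const (c k) * fps_X)"
proof -
  define H where "H k = Abs_fps (\<lambda>n. cfrac_coeff c n k)" for k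
  have nth: "fps_nth (fps_const a * fps_X * F) n = (if n = 0 then 0 else a * fps_nth F (n - 1))"
    for a :: 'a and F n
    by (simp add: mult.assoc)
  have "has_cfrac (H 0) (\<lambda>k. fps_const (c k) * fps_X)"
  proof (rule has_cfrac_of_three_term)
    show "H 0 = 1 + fps_const (c 0) * fps_X * H 1"
    proof (rule fps_ext)
      fix n show "fps_nth (H 0) n = fps_nth (1 + fps_const (c 0) * fps_X * H 1) n"
        by (cases n) (simp_all add: nth H_def)
    qed
    show "H (Suc k) = H k + fps_const (c (Suc k)) * fps_X * H (Suc (Suc k))" for k
    proof (rule fps_ext)
      fix n show "fps_nth (H (Suc k)) n
          = fps_nth (H k + fps_const (c (Suc k)) * fps_X * H (Suc (Suc k))) n"
        by (cases n) (simp_all add: nth H_def)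
    qed
  qed
  then show ?thesis by (simp add: H_def)
qed

section \<open>Adjacent and vincular patterns in lists\<close>

fun adj_count :: "('b \<Rightarrow> 'b \<Rightarrow> bool) \<Rightarrow> 'b list \<Rightarrow> nat" where
  "adj_count P (a # b # l) = of_bool (P a b) + adj_count P (b # l)"
| "adj_count P _ = 0"

lemma adj_count_append:
  "adj_count P (xs @ a # ys) = adj_count P (xs @ [a]) + adj_count P (a # ys)"
proof (induction xs)
  case (Cons b xs)
  then show ?case by (cases xs) simp_all
qed simp

text \<open>The explicit letter \<open>b\<close> keeps the rule from matching
  \<open>xs @ [a]\<close> on its own right-hand side, so that rewriting terminates.\<close>

lemma adj_count_append_Cons:
  "adj_count P (xs @ a # b # ys) = adj_count P (xs @ [a]) + adj_count P (a # b # ys)"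
  by (rule adj_count_append)

lemma adj_count_eq_0:
  "(\<And>a b. a \<in> set l \<Longrightarrow> b \<in> set l \<Longrightarrow> \<not> P a b) \<Longrightarrow> adj_count P l = 0"
  by (induction P l rule: adj_count.induct) auto

lemma adj_count_cong:
  "(\<And>a b. a \<in> set l \<Longrightarrow> b \<in> set l \<Longrightarrow> P a b = Q a b) \<Longrightarrow> adj_count P l = adj_count Q l"
  by (induction P l rule: adj_count.induct) auto

lemma adj_count_Cons_neutral:
  "(\<And>a. a \<in> set l \<Longrightarrow> \<not> P t a) \<Longrightarrow> adj_count P (t # l) = adj_count P l"
  by (cases l) auto

lemma adj_count_snoc_neutral:
  assumes "\<And>a. a \<in> set l \<Longrightarrow> \<not> P a t"
  shows "adj_count P (l @ [t]) = adj_count P l"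
proof (cases l rule: rev_cases)
  case (snoc l' a)
  then show ?thesis using assms adj_count_append[of P l' a "[t]"] by simp
qed simp

lemma adj_count_rev: "adj_count P (rev l) = adj_count (\<lambda>a b. P b a) l"
proof (induction l)
  case (Cons a l)
  show ?case
  proof (cases l)
    case (Cons b l')
    then show ?thesis
      using Cons.IH adj_count_append[of P "rev l'" b "[a]"] by simp
  qed simp
qed simp

lemma card_shift:
  fixes S :: "nat set"
  assumes "finite S"
  shows "card S = of_bool (0 \<in> S) + card {i. Suc i \<in> S}"
proof -
  have eq: "S = (if 0 \<in> S then {0} else {}) \<union> Suc ` {i. Suc i \<in> S}" (is "_ = ?A \<union> ?B")
    by (auto simp: image_iff) (metis not0_implies_Suc)+
  have "finite ?B" using assms by (rule finite_subset[rotated]) auto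
  then have "card S = card ?A + card ?B"
    by (subst eq, intro card_Un_disjoint) auto
  then show ?thesis by (simp add: card_image)
qed

lemma adj_count_card: "adj_count P l = card {i. Suc i < length l \<and> P (l ! i) (l ! Suc i)}"
proof (induction P l rule: adj_count.induct)
  case (1 P a b l)
  have "finite {i. Suc i < length (a # b # l) \<and> P ((a # b # l) ! i) ((a # b # l) ! Suc i)}"
    by (rule finite_subset[of _ "{..length (a # b # l)}"]) auto
  from card_shift[OF this] show ?case using 1 by simp
qed auto

text \<open>The isolated letter of the pattern comes first; patterns with the adjacent pair first
  are counted in the reversed word.\<close>

fun vinc_count :: "('b \<Rightarrow> 'b \<Rightarrow> 'b \<Rightarrow> bool) \<Rightarrow> 'b list \<Rightarrow> nat" where
  "vinc_count P [] = 0"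
| "vinc_count P (u # l) = adj_count (P u) l + vinc_count P l"

lemma vinc_count_card:
  "vinc_count P l = card {(i, j). i < j \<and> Suc j < length l \<and> P (l ! i) (l ! j) (l ! Suc j)}"
proof (induction l)
  case (Cons u l)
  let ?S = "{(i, j). i < j \<and> Suc j < length (u # l) \<and> P ((u # l) ! i) ((u # l) ! j) ((u # l) ! Suc j)}"
  let ?A = "{j. Suc j < length l \<and> P u (l ! j) (l ! Suc j)}"
  let ?B = "{(i, j). i < j \<and> Suc j < length l \<and> P (l ! i) (l ! j) (l ! Suc j)}"
  have eq: "?S = (\<lambda>j. (0, Suc j)) ` ?A \<union> (\<lambda>(i, j). (Suc i, Suc j)) ` ?B" (is "_ = ?A' \<union> ?B'")
  proof (intro set_eqI iffI)
    fix z assume "z \<in> ?S"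
    then obtain i j where z: "z = (i, j)" "i < j" "Suc j < length (u # l)"
      "P ((u # l) ! i) ((u # l) ! j) ((u # l) ! Suc j)" by auto
    from z(2) obtain j' where j: "j = Suc j'" by (cases j) auto
    show "z \<in> ?A' \<union> ?B'"
    proof (cases i)
      case 0
      then show ?thesis using z j by auto
    next
      case (Suc i')
      then have "(i', j') \<in> ?B" using z j by auto
      then show ?thesis using z j Suc by force
    qed
  qed auto
  have fA: "finite ?A" by (rule finite_subset[of _ "{..length l}"]) auto
  have fB: "finite ?B" by (rule finite_subset[of _ "{..length l} \<times> {..length l}"]) auto
  have "card ?S = card ?A' + card ?B'"
    unfolding eq using fA fB by (intro card_Un_disjoint) auto
  also have "card ?A' = card ?A" by (intro card_image) (auto simp: inj_on_def)
  also have "card ?B' = card ?B" by (intro card_image) (auto simp: inj_on_def)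
  finally show ?case using Cons by (simp add: adj_count_card)
qed simp

text \<open>A letter of \<open>A\<close> meets \<open>C\<close> through pairs inside
  \<open>C\<close> and, unless it is last in \<open>A\<close>, through the pair joining
  \<open>A\<close> to \<open>C\<close>. Sums on both sides avoid truncated subtraction.\<close>

lemma vinc_count_append_cong:
  assumes 1: "\<And>u a. u \<in> set A \<Longrightarrow> a \<in> set A \<Longrightarrow> adj_count (P u) (a # C) = adj_count (P u) (a # C')"
    and 2: "\<And>u. u \<in> set A \<Longrightarrow> adj_count (P u) C = adj_count (P u) C'"
  shows "vinc_count P (A @ C) + vinc_count P C' = vinc_count P (A @ C') + vinc_count P C"
proof -
  have adj: "adj_count (P u) (S @ C) = adj_count (P u) (S @ C')"
    if "u \<in> set A" "set S \<subseteq> set A" for u S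
  proof (cases S rule: rev_cases)
    case Nil
    then show ?thesis using 2 that by simp
  next
    case (snoc S' a)
    then show ?thesis using 1[of u a] that
      by (simp add: adj_count_append[of _ S' a C] adj_count_append[of _ S' a C'])
  qed
  have "vinc_count P (S @ C) + vinc_count P C' = vinc_count P (S @ C') + vinc_count P C"
    if "set S \<subseteq> set A" for S
    using that by (induction S) (auto simp: adj)
  then show ?thesis by blast
qed

lemma vinc_count_snoc_neutral:
  "(\<And>u a. u \<in> set l \<Longrightarrow> a \<in> set l \<Longrightarrow> \<not> P u a t) \<Longrightarrow> vinc_count P (l @ [t]) = vinc_count P l"
  by (induction l) (simp_all add: adj_count_snoc_neutral)

section \<open>Insertion of a maximal letter\<close>

text \<open>The number \<open>T\<close> plays the role of \<open>\<infinity>\<close>, and only ascents and descents ending in a letter other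
  than \<open>T\<close> are counted. No such condition is needed for \<open>des\<close> and the vincular patterns, as \<open>T\<close> is maximal.\<close>

definition asc :: "nat \<Rightarrow> nat list \<Rightarrow> nat" where
  "asc T = adj_count (\<lambda>a b. a < b \<and> b < T)"

definition des :: "nat list \<Rightarrow> nat" where
  "des = adj_count (\<lambda>a b. b < a)"

definition vinc_2_31 :: "nat list \<Rightarrow> nat" where
  "vinc_2_31 = vinc_count (\<lambda>u a b. b < u \<and> u < a)"

definition vinc_31_2 :: "nat list \<Rightarrow> nat" where
  "vinc_31_2 w = vinc_count (\<lambda>u a b. a < u \<and> u < b) (rev w)"

lemma pat_2_31_eq: "pat_2_31 w = vinc_2_31 w"
  by (simp add: pat_2_31_def vinc_2_31_def vinc_count_card)

lemma pat_31_2_eq: "pat_31_2 w = vinc_31_2 w"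
proof -
  let ?n = "length w"
  \<comment> \<open>Reversal exchanges the positions \<open>i\<close> and \<open>i + 1\<close> of
    the pair, so the new pair starts at the image of \<open>i + 1\<close>.\<close>
  let ?f = "\<lambda>(i, j). (?n - 1 - j, ?n - 2 - i)"
  let ?A = "{(i, j). Suc i < j \<and> j < ?n \<and> w ! Suc i < w ! j \<and> w ! j < w ! i}"
  let ?B = "{(i, j). i < j \<and> Suc j < length (rev w) \<and>
     rev w ! j < rev w ! i \<and> rev w ! i < rev w ! Suc j}"
  have "bij_betw ?f ?A ?B"
    by (rule bij_betw_byWitness[where f' = "\<lambda>(i, j). (?n - 2 - j, ?n - 1 - i)"])
       (auto simp: rev_nth Suc_diff_Suc numeral_2_eq_2 Suc_diff_le)
  then show ?thesis
    unfolding pat_31_2_def vinc_31_2_def vinc_count_card by (rule bij_betw_same_card)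
qed

text \<open>No letter but \<open>T\<close> exceeds \<open>u\<close>, and every \<open>T\<close>
  except a final one is followed by a letter below \<open>u\<close>.\<close>

lemma straddle_count:
  assumes "successively (\<lambda>a b. a \<noteq> T \<or> b \<noteq> T) l" "\<forall>e\<in>set l. e < u \<or> e = T" "u < (T::nat)"
  shows "adj_count (\<lambda>a b. b < u \<and> u < a) l + of_bool (l \<noteq> [] \<and> last l = T) = count_list l T"
  using assms by (induction "\<lambda>a b. b < u \<and> u < a" l rule: adj_count.induct) auto

text \<open>A letter after \<open>u\<close> is \<open>T\<close> or below \<open>u\<close>, so it
  ends no counted ascent; the step into \<open>u\<close> ascends exactly when no \<open>T\<close> is
  kept on its left.\<close>

lemma insert_max_asc:
  assumes "A \<noteq> []" "last A \<noteq> T" "\<forall>e\<in>set A \<union> set B. e < u \<or> e = T" "u < T" "r \<or> B \<noteq> []"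
  shows "asc T (A @ (if l then [T] else []) @ u # (if r then [T] else []) @ B)
    = asc T (A @ T # B) + of_bool (\<not> l)"
proof -
  obtain A' a where A: "A = A' @ [a]" using assms(1) by (cases A rule: rev_cases) auto
  have "a < u" using assms A by auto
  then show ?thesis
    using assms
    by (cases B) (auto simp: A asc_def adj_count_append_Cons)
qed

text \<open>For nonempty \<open>B\<close>, the descent from the old \<open>T\<close> to the head of
  \<open>B\<close> persists, starting at the right \<open>T\<close> or else at \<open>u\<close>.
  Only a left \<open>T\<close> adds a descent, to \<open>u\<close>.\<close>

lemma insert_max_des:
  assumes "A \<noteq> []" "last A \<noteq> T" "\<forall>e\<in>set A \<union> set B. e < u \<or> e = T" "u < T" "r \<or> B \<noteq> []"
    "B \<noteq> [] \<longrightarrow> hd B \<noteq> T"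
  shows "des (A @ (if l then [T] else []) @ u # (if r then [T] else []) @ B)
    = des (A @ T # B) + of_bool l"
proof -
  obtain A' a where A: "A = A' @ [a]" using assms(1) by (cases A rule: rev_cases) auto
  have "a < u" using assms A by auto
  then show ?thesis
    using assms
    by (cases B) (auto simp: A des_def adj_count_append_Cons)
qed

text \<open>To a letter below \<open>u\<close>, the tops \<open>u\<close> and \<open>T\<close> look
  alike, and nothing exceeds \<open>T\<close>, so old letters keep their patterns. The new ones have
  \<open>u\<close> as isolated letter, straddled by descents on its right.\<close>

lemma insert_max_vinc_2_31:
  assumes "\<forall>e\<in>set A \<union> set B. e < u \<or> e = T" "u < T" "r \<or> B \<noteq> []" "B \<noteq> [] \<longrightarrow> hd B \<noteq> T"
  shows "vinc_2_31 (A @ (if l then [T] else []) @ u # (if r then [T] else []) @ B)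
    = vinc_2_31 (A @ T # B) +
      adj_count (\<lambda>a b. b < u \<and> u < a) ((if r then [T] else []) @ B)"
proof -
  let ?P = "\<lambda>u a b. b < u \<and> u < (a::nat)"
  let ?L = "if l then [T] else []" and ?R = "if r then [T] else []"
  have le: "e \<le> T" if "e \<in> insert u (insert T (set B))" for e
    using that assms(1,2) by (auto dest!: bspec[of _ _ e])
  have T: "adj_count (?P T) zs = 0" if "set zs \<subseteq> insert u (insert T (set B))" for zs
  proof (rule adj_count_eq_0)
    fix a b assume "a \<in> set zs" "b \<in> set zs"
    then have "a \<le> T" "b \<le> T" using that le by blast+
    then show "\<not> ?P T a b" by simp
  qed
  have "vinc_count ?P (A @ T # B) + vinc_count ?P (?L @ u # ?R @ B)
      = vinc_count ?P (A @ ?L @ u # ?R @ B) + vinc_count ?P (T # B)"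
  proof (rule vinc_count_append_cong)
    fix v a assume "v \<in> set A" "a \<in> set A"
    then have "v < u \<or> v = T" "a < u \<or> a = T" using assms by auto
    then show "adj_count (?P v) (a # T # B) = adj_count (?P v) (a # ?L @ u # ?R @ B)"
      using assms by (cases B; cases l; cases r) auto
  next
    fix v assume "v \<in> set A"
    then have "v < u \<or> v = T" using assms by auto
    then show "adj_count (?P v) (T # B) = adj_count (?P v) (?L @ u # ?R @ B)"
      using assms by (cases B; cases l; cases r) auto
  qed
  moreover have "vinc_count ?P (T # B) = vinc_count ?P B"
    using T[of B] by auto
  moreover have "vinc_count ?P (?L @ u # ?R @ B) = adj_count (?P u) (?R @ B) + vinc_count ?P B"
    by (auto simp: T subset_insertI2)
  ultimately show ?thesis by (simp add: vinc_2_31_def)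
qed

text \<open>Mirror image of the previous count, on reversed words: now the descents on the left of
  \<open>u\<close> straddle it.\<close>

lemma insert_max_vinc_31_2:
  assumes "\<forall>e\<in>set A \<union> set B. e < u \<or> e = T" "u < T" "A \<noteq> []" "last A \<noteq> T"
  shows "vinc_31_2 (A @ (if l then [T] else []) @ u # (if r then [T] else []) @ B)
    = vinc_31_2 (A @ T # B) +
      adj_count (\<lambda>a b. b < u \<and> u < a) (A @ (if l then [T] else []))"
proof -
  let ?P = "\<lambda>u a b. a < u \<and> u < (b::nat)"
  let ?L = "if l then [T] else []" and ?R = "if r then [T] else []"
  have le: "e \<le> T" if "e \<in> insert u (insert T (set A))" for e
    using that assms(1,2) by (auto dest!: bspec[of _ _ e])
  have T: "adj_count (?P T) zs = 0" if "set zs \<subseteq> insert u (insert T (set A))" for zs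
  proof (rule adj_count_eq_0)
    fix a b assume "a \<in> set zs" "b \<in> set zs"
    then have "a \<le> T" "b \<le> T" using that le by blast+
    then show "\<not> ?P T a b" by simp
  qed
  obtain A' a where A: "A = A' @ [a]" using assms(3) by (cases A rule: rev_cases) auto
  have "a < u" using assms A by auto
  have "vinc_count ?P (rev B @ T # rev A) + vinc_count ?P (?R @ u # ?L @ rev A)
      = vinc_count ?P (rev B @ ?R @ u # ?L @ rev A) + vinc_count ?P (T # rev A)"
  proof (rule vinc_count_append_cong)
    fix v b assume "v \<in> set (rev B)" "b \<in> set (rev B)"
    then have "v < u \<or> v = T" "b < u \<or> b = T" using assms by auto
    then show "adj_count (?P v) (b # T # rev A) = adj_count (?P v) (b # ?R @ u # ?L @ rev A)"
      using \<open>u < T\<close> \<open>a < u\<close> by (cases l; cases r) (auto simp: A)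
  next
    fix v assume "v \<in> set (rev B)"
    then have "v < u \<or> v = T" using assms by auto
    then show "adj_count (?P v) (T # rev A) = adj_count (?P v) (?R @ u # ?L @ rev A)"
      using \<open>u < T\<close> \<open>a < u\<close> by (cases l; cases r) (auto simp: A)
  qed
  moreover have "vinc_count ?P (T # rev A) = vinc_count ?P (rev A)"
    using T[of "rev A"] by auto
  moreover have "vinc_count ?P (?R @ u # ?L @ rev A)
      = adj_count (?P u) (?L @ rev A) + vinc_count ?P (rev A)"
    by (auto simp: T subset_insertI2)
  moreover have "adj_count (?P u) (?L @ rev A) = adj_count (\<lambda>a b. b < u \<and> u < a) (A @ ?L)"
    using adj_count_rev[of "?P u" "A @ ?L"] by (cases l) simp_all
  moreover have "rev (A @ ?L @ u # ?R @ B) = rev B @ ?R @ u # ?L @ rev A" by simp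
  ultimately show ?thesis by (simp add: vinc_31_2_def)
qed

section \<open>The weighted enumeration of words\<close>

definition weight :: "'a::comm_ring_1 \<Rightarrow> 'a \<Rightarrow> 'a \<Rightarrow> 'a \<Rightarrow> nat \<Rightarrow> nat list \<Rightarrow> 'a" where
  "weight x y p q T w = x ^ asc T w * y ^ des w * p ^ vinc_2_31 w * q ^ vinc_31_2 w"

text \<open>Each \<open>T\<close> stands for a maximal run of letters not yet inserted, so no two
  are adjacent; the leading \<open>0\<close> is the left sentinel.\<close>

definition words :: "nat \<Rightarrow> nat \<Rightarrow> nat \<Rightarrow> nat list set" where
  "words T v h = {w. mset w = mset_set {0..v} + replicate_mset (Suc h) T \<and> hd w = 0 \<and> last w = T \<and>
     successively (\<lambda>a b. a \<noteq> T \<or> b \<noteq> T) w}"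

lemma finite_words: "finite (words T v h)"
  by (rule finite_subset[OF _ finite_permutations_of_multiset
        [of "mset_set {0..v} + replicate_mset (Suc h) T"]])
     (auto simp: words_def permutations_of_multiset_def)

section \<open>Weighted choice of a letter \<open>T\<close>\<close>

definition splits :: "'b \<Rightarrow> 'b list \<Rightarrow> ('b list \<times> 'b list) set" where
  "splits T w = {(A, B). A @ T # B = w}"

lemma splits_Nil [simp]: "splits T [] = {}"
  by (simp add: splits_def)

lemma splits_Cons:
  "splits T (a # w) =
     (if a = T then {([], w)} else {}) \<union> (\<lambda>(A, B). (a # A, B)) ` splits T w"
  by (auto simp: splits_def Cons_eq_append_conv append_eq_Cons_conv image_iff)

lemma finite_splits: "finite (splits T w)"
  by (induction w) (auto simp: splits_Cons)

text \<open>The occurrences of \<open>T\<close> are numbered from left to right by the number of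
  letters \<open>T\<close> before them.\<close>

lemma sum_splits:
  fixes f :: "nat \<Rightarrow> 'a::comm_monoid_add"
  shows "(\<Sum>(A, B)\<in>splits T w. f (count_list A T)) = (\<Sum>j<count_list w T. f j)"
proof (induction w arbitrary: f)
  case (Cons a w)
  let ?g = "\<lambda>(A, B). (a # A, B)"
  have inj: "inj_on ?g (splits T w)" by (auto simp: inj_on_def)
  show ?case
  proof (cases "a = T")
    case True
    have "(\<Sum>(A, B)\<in>splits T (a # w). f (count_list A T))
        = f 0 + (\<Sum>(A, B)\<in>?g ` splits T w. f (count_list A T))"
      unfolding splits_Cons using True
      by (subst sum.union_disjoint) (auto simp: finite_splits)
    also have "(\<Sum>(A, B)\<in>?g ` splits T w. f (count_list A T))
        = (\<Sum>(A, B)\<in>splits T w. f (Suc (count_list A T)))"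
      using True by (subst sum.reindex[OF inj]) (auto intro!: sum.cong)
    also have "\<dots> = (\<Sum>j<count_list w T. f (Suc j))" by (rule Cons.IH)
    finally show ?thesis using True by (simp add: sum.lessThan_Suc_shift del: sum.lessThan_Suc)
  next
    case False
    then have "(\<Sum>(A, B)\<in>splits T (a # w). f (count_list A T))
        = (\<Sum>(A, B)\<in>splits T w. f (count_list A T))"
      unfolding splits_Cons by (simp add: sum.reindex[OF inj]) (auto intro!: sum.cong)
    then show ?thesis using False Cons.IH by simp
  qed
qed simp

lemma words_splitD:
  assumes "A @ T # B \<in> words T v h" "v < T"
  shows "A \<noteq> []" "last A \<noteq> T" "B \<noteq> [] \<longrightarrow> hd B \<noteq> T" "B \<noteq> [] \<longrightarrow> last B = T"
    "\<forall>e\<in>set A \<union> set B. e < Suc v \<or> e = T"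
    "count_list A T + count_list B T = h"
    "successively (\<lambda>a b. a \<noteq> T \<or> b \<noteq> T) A" "successively (\<lambda>a b. a \<noteq> T \<or> b \<noteq> T) B"
proof -
  let ?P = "\<lambda>a b. a \<noteq> T \<or> b \<noteq> T"
  have m: "mset (A @ T # B) = mset_set {0..v} + replicate_mset (Suc h) T"
    and hd: "hd (A @ T # B) = 0" and last: "last (A @ T # B) = T"
    and s: "successively ?P (A @ T # B)"
    using assms by (auto simp: words_def)
  show "A \<noteq> []" using hd assms(2) by (cases A) auto
  then show "last A \<noteq> T" "B \<noteq> [] \<longrightarrow> hd B \<noteq> T" "successively ?P A" "successively ?P B"
    using s by (auto simp: successively_append_iff successively_Cons)
  show "B \<noteq> [] \<longrightarrow> last B = T" using last by auto
  have "set_mset (mset (A @ T # B)) \<subseteq> insert T {0..v}" unfolding m by auto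
  then show "\<forall>e\<in>set A \<union> set B. e < Suc v \<or> e = T" by auto
  have "count (mset (A @ T # B)) T = Suc h" unfolding m using assms(2) by simp
  then show "count_list A T + count_list B T = h" by (simp add: count_mset)
qed

definition insert_max :: "nat \<Rightarrow> nat \<Rightarrow> bool \<Rightarrow> bool \<Rightarrow> nat list \<Rightarrow> nat list \<Rightarrow> nat list" where
  "insert_max T u l r A B = A @ (if l then [T] else []) @ u # (if r then [T] else []) @ B"

text \<open>As the word ends in \<open>T\<close>, \<open>B\<close> is empty just at the last of the
  \<open>h + 1\<close> occurrences, the one preceded by \<open>h\<close> others.\<close>

lemma slot_iff_count_less:
  assumes "A @ T # B \<in> words T v h" "v < T"
  shows "(r \<or> B \<noteq> []) \<longleftrightarrow> count_list A T < h + of_bool r"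
proof -
  have "count_list B T = 0 \<longleftrightarrow> B = []"
    using words_splitD(4)[OF assms] by (metis count_list_0_iff last_in_set list.set(1) empty_iff)
  then show ?thesis using words_splitD(6)[OF assms] by (cases r) auto
qed

lemma weight_insert_max:
  fixes x y p q :: "'a::comm_ring_1"
  assumes w: "A @ T # B \<in> words T v h" and T: "Suc v < T" and r: "r \<or> B \<noteq> []"
  shows "weight x y p q T (insert_max T (Suc v) l r A B) =
    weight x y p q T (A @ T # B) * (if l then y else x) *
    (p ^ (h + of_bool r - 1 - count_list A T) * q ^ count_list A T)"
proof -
  have "v < T" using T by simp
  note D = words_splitD[OF w this]
  let ?L = "if l then [T] else []" and ?R = "if r then [T] else []"
  let ?str = "adj_count (\<lambda>a b. b < Suc v \<and> Suc v < a)"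
  \<comment> \<open>A \<open>T\<close> supplied by \<open>?L\<close> is last in this list and tops
    no descent, so only the letters \<open>T\<close> of \<open>A\<close> count.\<close>
  have "?str (A @ ?L) + of_bool (A @ ?L \<noteq> [] \<and> last (A @ ?L) = T) = count_list (A @ ?L) T"
    using D T by (intro straddle_count) (auto simp: successively_append_iff)
  then have left: "?str (A @ ?L) = count_list A T"
    using D by (auto split: if_splits)
  \<comment> \<open>\<open>?R @ B\<close> always ends in \<open>T\<close>; this final
    \<open>T\<close> tops no descent, whence the \<open>- 1\<close> in the exponent of
    \<open>p\<close>.\<close>
  have "?str (?R @ B) + of_bool (?R @ B \<noteq> [] \<and> last (?R @ B) = T) = count_list (?R @ B) T"
    using D T by (intro straddle_count) (auto simp: successively_append_iff successively_Cons)
  then have "?str (?R @ B) + 1 = count_list B T + of_bool r"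
    using D r by (auto split: if_splits)
  then have right: "?str (?R @ B) = h + of_bool r - 1 - count_list A T"
    using D(6) by linarith
  show ?thesis
    unfolding weight_def insert_max_def
      insert_max_asc[OF D(1,2,5) T r] insert_max_des[OF D(1,2,5) T r D(3)]
      insert_max_vinc_2_31[OF D(5) T r D(3)] insert_max_vinc_31_2[OF D(5) T D(1,2)] left right
    by (cases l) (simp_all add: power_add mult_ac)
qed

definition slots :: "nat \<Rightarrow> nat \<Rightarrow> nat \<Rightarrow> bool \<Rightarrow> (nat list \<times> nat list) set" where
  "slots T v h r = {(A, B). A @ T # B \<in> words T v h \<and> (r \<or> B \<noteq> [])}"

lemma slots_UN: "slots T v h r = (\<Union>w\<in>words T v h. {s \<in> splits T w. r \<or> snd s \<noteq> []})"
  by (auto simp: slots_def splits_def)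

lemma finite_slots: "finite (slots T v h r)"
  by (simp add: slots_UN finite_words finite_splits)

definition total :: "'a::comm_ring_1 \<Rightarrow> 'a \<Rightarrow> 'a \<Rightarrow> 'a \<Rightarrow> nat \<Rightarrow> nat \<Rightarrow> nat \<Rightarrow> 'a" where
  "total x y p q T v h = (\<Sum>w\<in>words T v h. weight x y p q T w)"

text \<open>In each word exactly \<open>h + of_bool r\<close> slots are admissible; the one with
  \<open>j\<close> letters \<open>T\<close> on its left contributes one monomial of the
  bracket.\<close>

lemma sum_slots:
  fixes x y p q :: "'a::comm_ring_1"
  assumes T: "Suc v < T"
  shows "(\<Sum>(A, B)\<in>slots T v h r. weight x y p q T (insert_max T (Suc v) l r A B)) =
    (if l then y else x) * pq_bracket p q (h + of_bool r) * total x y p q T v h"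
proof -
  let ?z = "if l then y else x"
  let ?g = "\<lambda>j. p ^ (h + of_bool r - 1 - j) * q ^ j"
  let ?n = "h + of_bool r"
  have one: "(\<Sum>(A, B)\<in>{s \<in> splits T w. r \<or> snd s \<noteq> []}. weight x y p q T (insert_max T (Suc v) l r A B))
      = ?z * pq_bracket p q ?n * weight x y p q T w" if w: "w \<in> words T v h" for w
  proof -
    \<comment> \<open>Padding the forbidden slot with zero extends the sum to all occurrences, as
      \<open>sum_splits\<close> requires.\<close>
    have "(\<Sum>(A, B)\<in>{s \<in> splits T w. r \<or> snd s \<noteq> []}. weight x y p q T (insert_max T (Suc v) l r A B))
      = (\<Sum>(A, B)\<in>splits T w. weight x y p q T w * ?z *
           (if count_list A T < ?n then ?g (count_list A T) else 0))"
    proof (rule sum.mono_neutral_cong_left)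
      show "\<forall>s\<in>splits T w - {s \<in> splits T w. r \<or> snd s \<noteq> []}.
          (case s of (A, B) \<Rightarrow> weight x y p q T w * ?z *
           (if count_list A T < ?n then ?g (count_list A T) else 0)) = 0"
      proof
        fix s assume s: "s \<in> splits T w - {s \<in> splits T w. r \<or> snd s \<noteq> []}"
        obtain A B where AB: "s = (A, B)" by (cases s)
        have "\<not> count_list A T < ?n"
          using slot_iff_count_less[of A T B v h r] s w T by (auto simp: AB splits_def)
        then show "(case s of (A, B) \<Rightarrow> weight x y p q T w * ?z *
           (if count_list A T < ?n then ?g (count_list A T) else 0)) = 0"
          by (simp add: AB)
      qed
    next
      fix s assume s: "s \<in> {s \<in> splits T w. r \<or> snd s \<noteq> []}"
      obtain A B where AB: "s = (A, B)" by (cases s)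
      have w': "w = A @ T # B" "r \<or> B \<noteq> []" using s AB by (auto simp: splits_def)
      then have "count_list A T < ?n"
        using slot_iff_count_less[of A T B v h r] w T by auto
      then show "(case s of (A, B) \<Rightarrow> weight x y p q T (insert_max T (Suc v) l r A B)) =
          (case s of (A, B) \<Rightarrow> weight x y p q T w * ?z *
           (if count_list A T < ?n then ?g (count_list A T) else 0))"
        using weight_insert_max[of A T B v h r x y p q l] w w' T by (simp add: AB)
    qed (auto simp: finite_splits)
    also have "\<dots> = weight x y p q T w * ?z *
        (\<Sum>(A, B)\<in>splits T w. (if count_list A T < ?n then ?g (count_list A T) else 0))"
      by (simp add: sum_distrib_left case_prod_unfold)
    also have "(\<Sum>(A, B)\<in>splits T w. (if count_list A T < ?n then ?g (count_list A T) else 0))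
        = (\<Sum>j<count_list w T. if j < ?n then ?g j else 0)"
      by (rule sum_splits)
    also have "count_list w T = Suc h"
    proof -
      have "count (mset w) T = count (mset_set {0..v} + replicate_mset (Suc h) T) T"
        using w by (simp add: words_def)
      then show ?thesis using T by (simp add: count_mset)
    qed
    also have "(\<Sum>j<Suc h. if j < ?n then ?g j else 0) = (\<Sum>j<?n. ?g j)"
      by (rule sum.mono_neutral_cong_right) auto
    also have "\<dots> = pq_bracket p q ?n"
      unfolding pq_bracket_def
      by (subst sum.nat_diff_reindex[symmetric]) (auto intro!: sum.cong)
    finally show ?thesis by (simp add: mult_ac)
  qed
  have "(\<Sum>(A, B)\<in>slots T v h r. weight x y p q T (insert_max T (Suc v) l r A B))
      = (\<Sum>w\<in>words T v h. \<Sum>(A, B)\<in>{s \<in> splits T w. r \<or> snd s \<noteq> []}.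
          weight x y p q T (insert_max T (Suc v) l r A B))"
    unfolding slots_UN
    by (rule sum.UNION_disjoint) (simp add: finite_words, simp add: finite_splits, auto simp: splits_def)
  also have "\<dots> = (\<Sum>w\<in>words T v h. ?z * pq_bracket p q ?n * weight x y p q T w)"
    by (rule sum.cong[OF refl one])
  finally show ?thesis by (simp add: total_def sum_distrib_left)
qed

text \<open>The slots, in words of any number of letters \<open>T\<close>, from which the insertion of type \<open>(l, r)\<close> leads to
  a word with \<open>h' + 1\<close> letters \<open>T\<close>.\<close>

definition moves :: "nat \<Rightarrow> nat \<Rightarrow> nat \<Rightarrow> bool \<times> bool \<Rightarrow> (nat list \<times> nat list) set" where
  "moves T v h' = (\<lambda>(l, r).
     {s. \<exists>h. h + of_bool l + of_bool r = Suc h' \<and> s \<in> slots T v h r})"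

section \<open>The insertion bijection\<close>

lemma insert_max_in_words:
  assumes T: "Suc v < T" and s: "A @ T # B \<in> words T v h" "r \<or> B \<noteq> []"
    and h: "h + of_bool l + of_bool r = Suc h'"
  shows "insert_max T (Suc v) l r A B \<in> words T (Suc v) h'"
proof -
  have "v < T" using T by simp
  note D = words_splitD[OF s(1) this]
  have m: "mset A + mset B = mset_set {0..v} + replicate_mset h T"
    using s(1) by (simp add: words_def)
  have "mset (insert_max T (Suc v) l r A B)
      = mset A + mset B + add_mset (Suc v) (replicate_mset (of_bool l + of_bool r) T)"
    by (simp add: insert_max_def)
  also have "\<dots> = add_mset (Suc v) (mset_set {0..v}) + (replicate_mset h T + replicate_mset (of_bool l + of_bool r) T)"
    unfolding m by simp
  \<comment> \<open>The slot uses up one of the \<open>h + 1\<close> letters \<open>T\<close>;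
    \<open>l\<close> and \<open>r\<close> each put one back.\<close>
  also have "replicate_mset h T + replicate_mset (of_bool l + of_bool r) T = replicate_mset (Suc h') T"
    unfolding h[symmetric] by (simp add: multiset_eq_iff)
  also have "add_mset (Suc v) (mset_set {0..v}) = mset_set {0..Suc v}"
    by (simp add: atLeast0_atMost_Suc)
  finally have "mset (insert_max T (Suc v) l r A B) = mset_set {0..Suc v} + replicate_mset (Suc h') T" .
  moreover have "hd (insert_max T (Suc v) l r A B) = 0"
    using s(1) D(1) by (simp add: words_def insert_max_def)
  moreover have "last (insert_max T (Suc v) l r A B) = T"
    using D(4) s(2) by (auto simp: insert_max_def)
  moreover have "successively (\<lambda>a b. a \<noteq> T \<or> b \<noteq> T) (insert_max T (Suc v) l r A B)"
    using D T by (auto simp: insert_max_def successively_append_iff successively_Cons)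
  ultimately show ?thesis by (simp add: words_def)
qed

text \<open>The neighbours of \<open>Suc v\<close> determine \<open>l\<close> and \<open>r\<close>;
  contracting \<open>Suc v\<close> and any adjacent \<open>T\<close> to a single \<open>T\<close>
  undoes the insertion.\<close>

lemma words_Suc_obtain_insert_max:
  assumes T: "Suc v < T" and w: "w \<in> words T (Suc v) h'"
  obtains l r A B h where "h + of_bool l + of_bool r = Suc h'" "A @ T # B \<in> words T v h"
    "r \<or> B \<noteq> []" "w = insert_max T (Suc v) l r A B"
proof -
  let ?P = "\<lambda>a b. a \<noteq> T \<or> b \<noteq> T"
  have m: "mset w = mset_set {0..Suc v} + replicate_mset (Suc h') T"
    and hd: "hd w = 0" and last: "last w = T" and succ: "successively ?P w"
    using w by (auto simp: words_def)
  have "Suc v \<in># mset w" unfolding m by simp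
  then obtain X Y where XY: "w = X @ Suc v # Y" by (metis in_multiset_in_set split_list)
  have X: "X \<noteq> []" "hd X = 0" using hd XY by (cases X; auto)+
  have Y: "Y \<noteq> []" "last Y = T" using last XY T by (cases Y rule: rev_cases; auto)+
  define l where "l \<longleftrightarrow> last X = T"
  define r where "r \<longleftrightarrow> hd Y = T"
  define A where "A = (if l then butlast X else X)"
  define B where "B = (if r then tl Y else Y)"
  have XA: "X = A @ (if l then [T] else [])"
    using X by (auto simp: A_def l_def)
  have YB: "Y = (if r then [T] else []) @ B"
    using Y by (cases Y) (auto simp: B_def r_def)
  have wins: "w = insert_max T (Suc v) l r A B"
    using XA YB XY by (simp add: insert_max_def)
  have "A \<noteq> []" "hd A = 0"
    using X XA T by (cases A; auto split: if_splits)+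
  note succ' = succ[unfolded wins insert_max_def]
  have "\<not> l \<Longrightarrow> last A \<noteq> T" by (simp add: A_def l_def)
  then have sA: "successively ?P A" "last A \<noteq> T"
    using succ' \<open>A \<noteq> []\<close> by (cases l; auto simp: successively_append_iff successively_Cons)+
  have "\<not> r \<Longrightarrow> hd B \<noteq> T" by (simp add: B_def r_def)
  then have sB: "successively ?P B" "B \<noteq> [] \<longrightarrow> hd B \<noteq> T"
    using succ' by (cases r; auto simp: successively_append_iff successively_Cons)+
  have rB: "r \<or> B \<noteq> []" "B \<noteq> [] \<longrightarrow> last B = T"
    using Y YB by (auto split: if_splits)
  have "add_mset (Suc v) (mset A + mset B + replicate_mset (of_bool l + of_bool r) T)
      = add_mset (Suc v) (mset_set {0..v} + replicate_mset (Suc h') T)"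
    using m unfolding wins by (cases l; cases r) (simp_all add: insert_max_def atLeast0_atMost_Suc)
  then have m': "mset A + mset B + replicate_mset (of_bool l + of_bool r) T
      = mset_set {0..v} + replicate_mset (Suc h') T" by simp
  define h where "h = count (mset A + mset B) T"
  have h: "h + of_bool l + of_bool r = Suc h'"
    using arg_cong[OF m', of "\<lambda>M. count M T"] T by (simp add: h_def)
  have "replicate_mset (Suc h') T = replicate_mset h T + replicate_mset (of_bool l + of_bool r) T"
    unfolding h[symmetric] by (simp add: multiset_eq_iff)
  then have "mset A + mset B = mset_set {0..v} + replicate_mset h T"
    using m' by (simp add: add.assoc[symmetric] del: replicate_mset_Suc)
  then have "A @ T # B \<in> words T v h"
    using \<open>A \<noteq> []\<close> \<open>hd A = 0\<close> sA sB rB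
    by (auto simp: words_def successively_append_iff successively_Cons)
  then show ?thesis using that h rB(1) wins by blast
qed

text \<open>\<open>Suc v\<close> occurs once and so fixes the cut; as \<open>A\<close> does not end
  and \<open>B\<close> does not begin with \<open>T\<close>, a \<open>T\<close> next to
  \<open>Suc v\<close> decides \<open>l\<close> and \<open>r\<close>.\<close>

lemma insert_max_inject:
  assumes T: "Suc v < T"
    and s: "A @ T # B \<in> words T v h" "A' @ T # B' \<in> words T v k"
    and eq: "insert_max T (Suc v) l r A B = insert_max T (Suc v) l' r' A' B'"
  shows "l = l' \<and> r = r' \<and> A = A' \<and> B = B'"
proof -
  have "v < T" using T by simp
  note D = words_splitD[OF s(1) this] and D' = words_splitD[OF s(2) this]
  have u: "Suc v \<notin> set (A @ (if l then [T] else []))" "Suc v \<notin> set ((if r then [T] else []) @ B)"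
    using D(5) T by auto
  have "A @ (if l then [T] else []) = A' @ (if l' then [T] else []) \<and>
        (if r then [T] else []) @ B = (if r' then [T] else []) @ B'"
    unfolding append_Cons_eq_iff[OF u, symmetric] using eq by (simp add: insert_max_def)
  then show ?thesis
    using D(2,3) D'(2,3) by (cases l; cases l'; cases r; cases r') auto
qed

lemma bij_betw_moves:
  assumes T: "Suc v < T"
  shows "bij_betw (\<lambda>((l, r), (A, B)). insert_max T (Suc v) l r A B)
    (Sigma UNIV (moves T v h')) (words T (Suc v) h')"
proof (rule bij_betw_imageI)
  show "inj_on (\<lambda>((l, r), (A, B)). insert_max T (Suc v) l r A B) (Sigma UNIV (moves T v h'))"
  proof (rule inj_onI)
    fix z z' assume z: "z \<in> Sigma UNIV (moves T v h')" "z' \<in> Sigma UNIV (moves T v h')"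
      and eq: "(\<lambda>((l, r), (A, B)). insert_max T (Suc v) l r A B) z
        = (\<lambda>((l, r), (A, B)). insert_max T (Suc v) l r A B) z'"
    obtain l r A B where 1: "z = ((l, r), (A, B))" by (metis surj_pair)
    obtain l' r' A' B' where 2: "z' = ((l', r'), (A', B'))" by (metis surj_pair)
    obtain h k where "A @ T # B \<in> words T v h" "A' @ T # B' \<in> words T v k"
      using z unfolding 1 2 by (auto simp: moves_def slots_def)
    then show "z = z'" using insert_max_inject[OF T] eq unfolding 1 2 by simp
  qed
  show "(\<lambda>((l, r), (A, B)). insert_max T (Suc v) l r A B) ` Sigma UNIV (moves T v h') = words T (Suc v) h'"
  proof (intro equalityI subsetI)
    fix w assume "w \<in> words T (Suc v) h'"
    then obtain l r A B h where "h + of_bool l + of_bool r = Suc h'" "A @ T # B \<in> words T v h"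
      "r \<or> B \<noteq> []" and w: "w = insert_max T (Suc v) l r A B"
      by (rule words_Suc_obtain_insert_max[OF T])
    then have "((l, r), (A, B)) \<in> Sigma UNIV (moves T v h')"
      by (auto simp: moves_def slots_def)
    then show "w \<in> (\<lambda>((l, r), (A, B)). insert_max T (Suc v) l r A B) ` Sigma UNIV (moves T v h')"
      unfolding w by (rule rev_image_eqI) simp
  next
    fix w assume "w \<in> (\<lambda>((l, r), (A, B)). insert_max T (Suc v) l r A B) ` Sigma UNIV (moves T v h')"
    then obtain l r A B h where w: "w = insert_max T (Suc v) l r A B"
      and s: "A @ T # B \<in> words T v h" "r \<or> B \<noteq> []" "h + of_bool l + of_bool r = Suc h'"
      by (auto simp: moves_def slots_def)
    show "w \<in> words T (Suc v) h'" unfolding w by (rule insert_max_in_words[OF T s])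
  qed
qed

text \<open>For \<open>h = 0\<close> the truncated subtraction is harmless because the empty bracket is \<open>0\<close>.\<close>

lemma total_Suc:
  fixes x y p q :: "'a::comm_ring_1"
  assumes T: "Suc v < T"
  shows "total x y p q T (Suc v) h =
    x * pq_bracket p q (Suc h) * (total x y p q T v h + total x y p q T v (Suc h)) +
    y * pq_bracket p q h * (total x y p q T v h + total x y p q T v (h - 1))"
proof -
  let ?wt = "weight x y p q T" and ?M = "total x y p q T v"
  let ?f = "\<lambda>lr s. ?wt (insert_max T (Suc v) (fst lr) (snd lr) (fst s) (snd s))"
  have moves: "moves T v h (False, True) = slots T v h True"
    "moves T v h (False, False) = slots T v (Suc h) False"
    "moves T v h (True, False) = slots T v h False"
    "moves T v h (True, True) = (if h = 0 then {} else slots T v (h - 1) True)"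
    by (auto simp: moves_def) (metis Suc_pred)?
  have fin: "finite (moves T v h lr)" for lr
    by (cases lr; cases "fst lr"; cases "snd lr") (auto simp: moves finite_slots)
  have "total x y p q T (Suc v) h
      = (\<Sum>z\<in>Sigma UNIV (moves T v h). ?f (fst z) (snd z))"
    unfolding total_def
    by (subst sum.reindex_bij_betw[OF bij_betw_moves[OF T], symmetric]) (simp add: case_prod_unfold)
  also have "\<dots> = (\<Sum>lr\<in>UNIV. \<Sum>s\<in>moves T v h lr. ?f lr s)"
    by (subst sum.Sigma) (auto simp: fin case_prod_unfold)
  also have "\<dots> = (\<Sum>s\<in>slots T v h True. ?f (False, True) s) + (\<Sum>s\<in>slots T v (Suc h) False. ?f (False, False) s)
      + (\<Sum>s\<in>slots T v h False. ?f (True, False) s)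
      + (if h = 0 then 0 else \<Sum>s\<in>slots T v (h - 1) True. ?f (True, True) s)"
    by (simp add: UNIV_Times_UNIV[symmetric] UNIV_bool insert_Times_insert moves ac_simps del: UNIV_Times_UNIV)
  \<comment> \<open>The bracket index is the source height, plus one if a right \<open>T\<close> is
    kept: sources \<open>h\<close>, \<open>h + 1\<close>, \<open>h\<close>, \<open>h - 1\<close>
    give \<open>h + 1\<close>, \<open>h + 1\<close>, \<open>h\<close>, \<open>h\<close>.\<close>
  also have "\<dots> = x * pq_bracket p q (Suc h) * ?M h + x * pq_bracket p q (Suc h) * ?M (Suc h)
      + y * pq_bracket p q h * ?M h + (if h = 0 then 0 else y * pq_bracket p q h * ?M (h - 1))"
    using sum_slots[OF T, of x y p q False True h] sum_slots[OF T, of x y p q False False "Suc h"]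
      sum_slots[OF T, of x y p q True False h] sum_slots[OF T, of x y p q True True "h - 1"]
    by (simp add: case_prod_unfold)
  also have "(if h = 0 then 0 else y * pq_bracket p q h * ?M (h - 1)) = y * pq_bracket p q h * ?M (h - 1)"
    by (simp add: pq_bracket_def)
  finally show ?thesis by (simp add: algebra_simps)
qed

section \<open>Initial values and comparison with Dyck paths\<close>

lemma words_0:
  assumes "0 < T"
  shows "words T 0 h = (if h = 0 then {[0, T]} else {})"
proof -
  have only: "h = 0 \<and> w = [0, T]" if "w \<in> words T 0 h" for w
  proof -
    have m: "mset w = add_mset 0 (replicate_mset (Suc h) T)" and hd: "hd w = 0"
      and s: "successively (\<lambda>a b. a \<noteq> T \<or> b \<noteq> T) w"
      using that by (simp_all add: words_def)
    have "w \<noteq> []" using m by auto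
    then obtain w' where w: "w = 0 # w'" using hd by (metis list.collapse)
    then have m': "mset w' = replicate_mset (Suc h) T" using m by simp
    have "set_mset (mset w') = {T}" unfolding m' by simp
    moreover have "size (mset w') = Suc h" unfolding m' by simp
    ultimately have "w' = replicate (Suc h) T"
      using replicate_length_same[of w' T] by simp
    then show ?thesis using s unfolding w by (cases h) simp_all
  qed
  have "[0, T] \<in> words T 0 0" using assms by (simp add: words_def)
  moreover have "words T 0 h \<subseteq> {[0, T]}" "h \<noteq> 0 \<Longrightarrow> words T 0 h = {}" using only by auto
  ultimately show ?thesis by (cases "h = 0") auto
qed

lemma total_0:
  assumes "0 < T"
  shows "total x y p q T 0 h = of_bool (h = 0)"
  using assms by (simp add: total_def words_0 weight_def asc_def des_def vinc_2_31_def vinc_31_2_def)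

text \<open>The product collects the weights of the up steps, which \<open>cfrac_coeff\<close> charges to the matching down
  steps and therefore omits for a path that has not returned to level \<open>0\<close>.\<close>

lemma total_eq_cfrac_coeff:
  fixes x y p q :: "'a::comm_ring_1"
  defines "c \<equiv> \<lambda>k. (if even k then x else y) * pq_bracket p q (k div 2 + 1)"
  assumes "v < T"
  shows "total x y p q T v h =
    (if h \<le> v then (\<Prod>i=1..h. y * pq_bracket p q i) * cfrac_coeff c (v - h) (2 * h) else 0)"
  using \<open>v < T\<close>
proof (induction v arbitrary: h)
  case 0
  then show ?case by (simp add: total_0)
next
  case (Suc v)
  let ?M = "total x y p q T" and ?s = "cfrac_coeff c"
  define Y where "Y h = (\<Prod>i=1..h. y * pq_bracket p q i)" for h
  have Y_Suc: "Y (Suc h) = Y h * (y * pq_bracket p q (Suc h))" for h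
    by (simp add: Y_def)
  have c: "c (2 * h) = x * pq_bracket p q (Suc h)" "c (Suc (2 * h)) = y * pq_bracket p q (Suc h)" for h
    by (simp_all add: c_def)
  have IH: "?M v h = (if h \<le> v then Y h * ?s (v - h) (2 * h) else 0)" for h
    using Suc by (simp add: Y_def)
  have "?M (Suc v) h = (if h \<le> Suc v then Y h * ?s (Suc v - h) (2 * h) else 0)"
  proof -
    note step = total_Suc[OF \<open>Suc v < T\<close>, of x y p q h]
    consider "h > Suc v" | "h = Suc v" | "h \<le> v" by linarith
    then show ?thesis
    proof cases
      case 1
      then have "\<not> h \<le> v" "\<not> Suc h \<le> v" "\<not> h - 1 \<le> v" "\<not> h \<le> Suc v" by auto
      then show ?thesis by (simp only: step IH if_False mult_zero_right add_0)
    next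
      case 2
      show ?thesis unfolding step IH using 2 by (simp add: Y_Suc)
    next
      case 3
      define m where "m = v - h"
      have vh: "v - h = m" "v - Suc h = m - 1" "Suc v - h = Suc m" "Suc h \<le> v \<longleftrightarrow> m \<noteq> 0"
        using 3 by (auto simp: m_def)
      \<comment> \<open>Height \<open>h\<close> corresponds to Dyck level \<open>2 * h\<close>; this
        eliminates the odd level between heights \<open>h\<close> and \<open>h + 1\<close>.\<close>
      have odd_level: "?s m (Suc (2 * h)) =
          ?s m (2 * h) + (if m = 0 then 0 else y * pq_bracket p q (Suc h) * ?s (m - 1) (2 * Suc h))"
        by (cases m) (simp_all add: c)
      have M: "?M v h = Y h * ?s m (2 * h)"
        "?M v (Suc h) = (if m = 0 then 0 else Y (Suc h) * ?s (m - 1) (2 * Suc h))"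
        using 3 by (simp_all only: IH vh if_True if_not_P split: if_split) simp_all
      \<comment> \<open>The \<open>x\<close> terms are the Dyck prefixes whose last step goes down
        from \<open>2 * h + 1\<close> to \<open>2 * h\<close>.\<close>
      have right: "x * pq_bracket p q (Suc h) * (?M v h + ?M v (Suc h))
          = Y h * (c (2 * h) * ?s m (Suc (2 * h)))"
        unfolding odd_level M c Y_Suc by (cases "m = 0") (simp_all only: if_True if_False simp_thms ring_distribs mult_ac add_0_right)
      show ?thesis
      proof (cases h)
        case 0
        \<comment> \<open>Level \<open>0\<close> is not entered by an up step, so the
          \<open>y\<close> terms must vanish.\<close>
        have "pq_bracket p q h = 0" by (simp add: 0 pq_bracket_def)
        then have "?M (Suc v) h = Y h * (c (2 * h) * ?s m (Suc (2 * h)))"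
          unfolding step right by simp
        then show ?thesis using vh(3) 0 by simp
      next
        case (Suc g)
        have "v - g = Suc m" "g \<le> v" using 3 Suc by (simp_all add: m_def)
        then have Mg: "?M v (h - 1) = Y g * ?s (Suc m) (2 * g)"
          by (simp only: IH Suc diff_Suc_1 if_True)
        \<comment> \<open>The \<open>y\<close> terms are the prefixes whose last step goes up from
          \<open>2 * g + 1\<close>. Their factor completes \<open>Y h\<close> in the term from
          height \<open>g\<close>, and is the down-step weight \<open>c (2 * g + 1)\<close> in the
          term from height \<open>h\<close>.\<close>
        have left: "y * pq_bracket p q h * (?M v h + ?M v (h - 1)) = Y h * ?s (Suc m) (Suc (2 * g))"
          unfolding Mg M(1) by (simp add: Suc Y_Suc c) (simp only: ring_distribs mult_ac add_ac)
        have "?s (Suc m) (2 * h) = ?s (Suc m) (Suc (2 * g)) + c (2 * h) * ?s m (Suc (2 * h))"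
          by (simp add: Suc)
        then have "?M (Suc v) h = Y h * ?s (Suc m) (2 * h)"
          unfolding step left right by (simp only: distrib_left add_ac)
        then show ?thesis using 3 by (simp only: vh(3)) simp
      qed
    qed
  qed
  then show ?case by (simp only: Y_def)
qed

section \<open>From words with a single \<open>T\<close> to permutations\<close>

text \<open>The leading \<open>0\<close> adds one ascent, the source of \<open>1 + pat_12\<close>,
  while the step into the final letter is not counted. Neither end letter takes part in a descent or
  is straddled by one.\<close>

lemma weight_permutation:
  assumes "set \<pi> \<subseteq> {1..n}" "\<pi> \<noteq> []"
  shows "weight x y p q (Suc n) (0 # \<pi> @ [Suc n]) =
    x ^ (1 + pat_12 \<pi>) * y ^ pat_21 \<pi> * p ^ pat_2_31 \<pi> * q ^ pat_31_2 \<pi>"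
proof -
  have bd: "0 < e \<and> e < Suc n" if "e \<in> set \<pi>" for e using that assms by auto
  have "asc (Suc n) (0 # \<pi> @ [Suc n]) = asc (Suc n) (0 # \<pi>)"
    unfolding asc_def append_Cons[symmetric] by (rule adj_count_snoc_neutral) simp
  also have "\<dots> = 1 + asc (Suc n) \<pi>"
    using assms bd by (cases \<pi>) (auto simp: asc_def)
  also have "asc (Suc n) \<pi> = pat_12 \<pi>"
    unfolding pat_12_def adj_count_card[symmetric] asc_def by (rule adj_count_cong) (use bd in auto)
  finally have 1: "asc (Suc n) (0 # \<pi> @ [Suc n]) = 1 + pat_12 \<pi>" .
  have "des (0 # \<pi> @ [Suc n]) = des (\<pi> @ [Suc n])"
    unfolding des_def by (rule adj_count_Cons_neutral) simp
  also have "\<dots> = des \<pi>"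
    unfolding des_def by (rule adj_count_snoc_neutral) (use bd in force)
  also have "\<dots> = pat_21 \<pi>"
    by (simp add: des_def pat_21_def adj_count_card)
  finally have 2: "des (0 # \<pi> @ [Suc n]) = pat_21 \<pi>" .
  have "vinc_2_31 (0 # \<pi> @ [Suc n]) = vinc_2_31 (\<pi> @ [Suc n])"
    by (simp add: vinc_2_31_def adj_count_eq_0)
  also have "\<dots> = vinc_2_31 \<pi>"
    unfolding vinc_2_31_def by (rule vinc_count_snoc_neutral) (use bd in force)
  finally have 3: "vinc_2_31 (0 # \<pi> @ [Suc n]) = pat_2_31 \<pi>" by (simp add: pat_2_31_eq)
  have "adj_count (\<lambda>a b. a < Suc n \<and> Suc n < b) (rev \<pi> @ [0]) = 0"
    by (rule adj_count_eq_0) (use bd in force)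
  then have "vinc_31_2 (0 # \<pi> @ [Suc n]) = vinc_count (\<lambda>u a b. a < u \<and> u < b) (rev \<pi> @ [0])"
    by (simp add: vinc_31_2_def)
  also have "\<dots> = vinc_31_2 \<pi>"
    unfolding vinc_31_2_def by (rule vinc_count_snoc_neutral) simp
  finally have 4: "vinc_31_2 (0 # \<pi> @ [Suc n]) = pat_31_2 \<pi>" by (simp add: pat_31_2_eq)
  show ?thesis unfolding weight_def 1 2 3 4 ..
qed

lemma words_full: "words (Suc n) n 0 = (\<lambda>\<pi>. 0 # \<pi> @ [Suc n]) ` permutations_of_set {1..n}"
proof (intro equalityI subsetI)
  have set0: "mset_set {0..n} = add_mset 0 (mset_set {1..n})"
    by (simp add: atLeastAtMost_insertL[symmetric])
  {
    fix w assume w: "w \<in> words (Suc n) n 0"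
    then have m: "mset w = add_mset 0 (mset_set {1..n}) + {#Suc n#}"
      and hd: "hd w = 0" and last: "last w = Suc n"
      by (auto simp: words_def set0)
    obtain w' where w': "w = 0 # w'" using m hd by (cases w) auto
    obtain \<pi> where \<pi>: "w' = \<pi> @ [Suc n]"
      using w' last by (cases w' rule: rev_cases) auto
    have "mset \<pi> = mset_set {1..n}" using m w' \<pi> by simp
    then have "\<pi> \<in> permutations_of_set {1..n}"
      by (metis finite_atLeastAtMost permutations_of_multisetI permutations_of_set_altdef)
    then show "w \<in> (\<lambda>\<pi>. 0 # \<pi> @ [Suc n]) ` permutations_of_set {1..n}"
      using w' \<pi> by auto
  next
    fix w assume "w \<in> (\<lambda>\<pi>. 0 # \<pi> @ [Suc n]) ` permutations_of_set {1..n}"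
    then obtain \<pi> where \<pi>: "w = 0 # \<pi> @ [Suc n]" "\<pi> \<in> permutations_of_set {1..n}" by auto
    then have m: "mset \<pi> = mset_set {1..n}" and s: "set \<pi> = {1..n}"
      by (auto simp: permutations_of_set_def mset_set_set[symmetric])
    have "\<pi> ! i \<noteq> Suc n" if "i < length \<pi>" for i
      using nth_mem[OF that] s by auto
    then have "successively (\<lambda>a b. a \<noteq> Suc n \<or> b \<noteq> Suc n) \<pi>"
      by (simp add: successively_conv_nth)
    moreover have "\<pi> \<noteq> [] \<Longrightarrow> last \<pi> \<noteq> Suc n"
      using last_in_set[of \<pi>] s by auto
    ultimately show "w \<in> words (Suc n) n 0"
      using m s unfolding \<pi>
      by (auto simp: words_def set0 successively_append_iff successively_Cons)
  }
qed

theorem theorem6: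
  fixes x y p q :: "'a::comm_ring_1"
  shows "has_cfrac
    (1 + Abs_fps (\<lambda>n. \<Sum>\<pi> \<in> permutations_of_set {1..n} - {[]}.
       x ^ (1 + pat_12 \<pi>) * y ^ pat_21 \<pi> * p ^ pat_2_31 \<pi> * q ^ pat_31_2 \<pi>))
    (\<lambda>k. fps_const ((if even k then x else y) * pq_bracket p q (k div 2 + 1)) * fps_X)"
proof -
  let ?c = "\<lambda>k. (if even k then x else y) * pq_bracket p q (k div 2 + 1)"
  let ?f = "\<lambda>\<pi>. x ^ (1 + pat_12 \<pi>) * y ^ pat_21 \<pi> * p ^ pat_2_31 \<pi> * q ^ pat_31_2 \<pi>"
  have "Abs_fps (\<lambda>n. cfrac_coeff ?c n 0)
      = 1 + Abs_fps (\<lambda>n. \<Sum>\<pi> \<in> permutations_of_set {1..n} - {[]}. ?f \<pi>)"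
  proof (rule fps_ext)
    fix n
    show "fps_nth (Abs_fps (\<lambda>n. cfrac_coeff ?c n 0)) n
      = fps_nth (1 + Abs_fps (\<lambda>n. \<Sum>\<pi> \<in> permutations_of_set {1..n} - {[]}. ?f \<pi>)) n"
    \<comment> \<open>For \<open>n = 0\<close> the only permutation \<open>[]\<close> is removed, so
      the constant coefficient comes from the summand \<open>1\<close>.\<close>
    proof (cases "n = 0")
      case False
      \<comment> \<open>At height \<open>0\<close> the product of up-step weights is empty.\<close>
      have "cfrac_coeff ?c n 0 = total x y p q (Suc n) n 0"
        by (simp add: total_eq_cfrac_coeff)
      also have "\<dots> = (\<Sum>\<pi>\<in>permutations_of_set {1..n}. weight x y p q (Suc n) (0 # \<pi> @ [Suc n]))"
        unfolding total_def words_full by (subst sum.reindex) (auto simp: inj_on_def)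
      also have "\<dots> = (\<Sum>\<pi> \<in> permutations_of_set {1..n} - {[]}. ?f \<pi>)"
      proof (rule sum.cong)
        show "permutations_of_set {1..n} = permutations_of_set {1..n} - {[]}"
          using False by (auto simp: permutations_of_set_def)
        fix \<pi> assume "\<pi> \<in> permutations_of_set {1..n} - {[]}"
        then show "weight x y p q (Suc n) (0 # \<pi> @ [Suc n]) = ?f \<pi>"
          by (intro weight_permutation) (auto simp: permutations_of_set_def)
      qed
      finally show ?thesis using False by simp
    qed simp
  qed
  then show ?thesis using has_cfrac_cfrac_coeff[of ?c] by simp
qed

end
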